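(* The function $g$ has no finite-fold Diophantine representation; that is, there is no polynomial $W(x_1,x_2,x_3,\ldots,x_m)$ with integer coefficients such that for all non-negative integers $x_1,x_2$ one has $x_2=g(x_1)$ (with $x_1\geq 1$) if and only if there exist $x_3,\ldots,x_m\in\mathbb{N}$ with $W(x_1,x_2,x_3,\ldots,x_m)=0$, and such that for all $x_1,x_2\in\mathbb{N}$ the equation $W(x_1,x_2,x_3,\ldots,x_m)=0$ has only finitely many solutions $(x_3,\ldots,x_m)\in\mathbb{N}^{m-2}$.
   Context: $\mathbb{N}=\{0,1,2,\ldots\}$. For a positive integer $n$, let $E_n=\{x_i=1,\ x_i+x_j=x_k,\ x_i\cdot x_j=x_k : i,j,k\in\{1,\ldots,n\}\}$. Let $g(n)$ denote the greatest finite total number of solutions of a subsystem of $E_n$ in integers $x_1,\ldots,x_n$ (i.e., the maximum, over all systems $S\subseteq E_n$ having only finitely many integer solutions, of the number of integer solutions of $S$). A Diophantine representation of a set $\mathcal{M}\subseteq\mathbb{N}^k$ is a polynomial $W(a_1,\ldots,a_k,x_1,\ldots,x_m)$ with integer coefficients such that $(a_1,\ldots,a_k)\in\mathcal{M}$ iff $\exists x_1,\ldots,x_m\in\mathbb{N}\ W(a_1,\ldots,a_k,x_1,\ldots,x_m)=0$; it is finite-fold if for every $(a_1,\ldots,a_k)\in\mathbb{N}^k$ the equation has only finitely many solutions $(x_1,\ldots,x_m)\in\mathbb{N}^m$. A Diophantine representation of a function is one of its graph. *)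

theory Defs
  imports Main "HOL-Library.FuncSet" "HOL-Library.Poly_Mapping"
begin

text \<open>The equations \<open>x\<^sub>i = 1\<close>, \<open>x\<^sub>i + x\<^sub>j = x\<^sub>k\<close> and \<open>x\<^sub>i \<cdot> x\<^sub>j = x\<^sub>k\<close>.\<close>

datatype equation = One_eq nat | Add_eq nat nat nat | Mult_eq nat nat nat

fun satisfies :: "(nat \<Rightarrow> int) \<Rightarrow> equation \<Rightarrow> bool" where
  "satisfies x (One_eq i) \<longleftrightarrow> x i = 1"
| "satisfies x (Add_eq i j k) \<longleftrightarrow> x i + x j = x k"
| "satisfies x (Mult_eq i j k) \<longleftrightarrow> x i * x j = x k"

definition E :: "nat \<Rightarrow> equation set" where
  "E n = {One_eq i | i. i \<in> {1..n}}
       \<union> {Add_eq i j k | i j k. i \<in> {1..n} \<and> j \<in> {1..n} \<and> k \<in> {1..n}}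
       \<union> {Mult_eq i j k | i j k. i \<in> {1..n} \<and> j \<in> {1..n} \<and> k \<in> {1..n}}"

text \<open>An integer tuple \<open>(x\<^sub>1, \<dots>, x\<^sub>n)\<close> is an extensional function on \<open>{1..n}\<close>, so that
  solutions are counted without multiplicity. Variables that do not occur in \<open>S\<close> are
  unconstrained but still belong to the tuple.\<close>

definition solutions :: "nat \<Rightarrow> equation set \<Rightarrow> (nat \<Rightarrow> int) set" where
  "solutions n S = {x \<in> {1..n} \<rightarrow>\<^sub>E UNIV. \<forall>e\<in>S. satisfies x e}"

definition g :: "nat \<Rightarrow> nat" where
  "g n = Max {card (solutions n S) | S. S \<subseteq> E n \<and> finite (solutions n S)}"

text \<open>The next two facts show that the maximum in the definition of \<open>g\<close> exists for positive \<open>n\<close>.\<close>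

lemma finite_E: "finite (E n)"
proof -
  let ?I = "{1..n} \<times> {1..n} \<times> {1..n}"
  have "E n \<subseteq> One_eq ` {1..n} \<union> (\<lambda>(i, j, k). Add_eq i j k) ` ?I \<union> (\<lambda>(i, j, k). Mult_eq i j k) ` ?I"
    unfolding E_def by (auto simp: image_iff Bex_def)
  moreover have "finite (One_eq ` {1..n} \<union> (\<lambda>(i, j, k). Add_eq i j k) ` ?I
      \<union> (\<lambda>(i, j, k). Mult_eq i j k) ` ?I)"
    by (intro finite_UnI finite_imageI finite_cartesian_product finite_atLeastAtMost)
  ultimately show ?thesis
    by (rule finite_subset)
qed

lemma g_Max_wellformed:
  assumes "n \<ge> 1"
  shows "finite {card (solutions n S) | S. S \<subseteq> E n \<and> finite (solutions n S)}"
    and "{card (solutions n S) | S. S \<subseteq> E n \<and> finite (solutions n S)} \<noteq> {}"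
proof -
  have "{card (solutions n S) | S. S \<subseteq> E n \<and> finite (solutions n S)}
      \<subseteq> (\<lambda>S. card (solutions n S)) ` Pow (E n)"
    by auto
  then show "finite {card (solutions n S) | S. S \<subseteq> E n \<and> finite (solutions n S)}"
    by (rule finite_subset) (simp add: finite_E)
  have "One_eq 1 \<in> E n" "Add_eq 1 1 1 \<in> E n"
    using assms by (auto simp: E_def)
  then have False if "x \<in> solutions n (E n)" for x
  proof -
    have "satisfies x (One_eq 1)" "satisfies x (Add_eq 1 1 1)"
      using that \<open>One_eq 1 \<in> E n\<close> \<open>Add_eq 1 1 1 \<in> E n\<close> unfolding solutions_def by blast+
    then show False
      by simp
  qed
  then have "solutions n (E n) = {}"
    by blast
  then have "finite (solutions n (E n))"
    by simp
  then show "{card (solutions n S) | S. S \<subseteq> E n \<and> finite (solutions n S)} \<noteq> {}"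
    by blast
qed

text \<open>A polynomial with integer coefficients in variables indexed by natural numbers: a finitely
  supported map from monomials (finitely supported exponent vectors) to coefficients.\<close>

type_synonym int_mpoly = "(nat \<Rightarrow>\<^sub>0 nat) \<Rightarrow>\<^sub>0 int"

definition vars :: "int_mpoly \<Rightarrow> nat set" where
  "vars W = (\<Union>t\<in>Poly_Mapping.keys W. Poly_Mapping.keys t)"

definition eval_poly :: "int_mpoly \<Rightarrow> (nat \<Rightarrow> int) \<Rightarrow> int" where
  "eval_poly W v = (\<Sum>t\<in>Poly_Mapping.keys W.
     Poly_Mapping.lookup W t * (\<Prod>i\<in>Poly_Mapping.keys t. v i ^ Poly_Mapping.lookup t i))"

text \<open>Tuples of natural numbers are lists of fixed length. Variables \<open>0, \<dots>, k - 1\<close> of the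
  polynomial are the parameters \<open>a\<close> and variables \<open>k, \<dots>, k + m - 1\<close> are the unknowns \<open>x\<close>.\<close>

definition nat_zeros :: "nat \<Rightarrow> int_mpoly \<Rightarrow> nat list \<Rightarrow> nat list set" where
  "nat_zeros m W a = {x. length x = m \<and> eval_poly W (\<lambda>i. int ((a @ x) ! i)) = 0}"

definition diophantine_representation :: "nat \<Rightarrow> nat \<Rightarrow> int_mpoly \<Rightarrow> nat list set \<Rightarrow> bool" where
  "diophantine_representation k m W M \<longleftrightarrow>
     vars W \<subseteq> {..<k + m} \<and>
     (\<forall>a. length a = k \<longrightarrow> (a \<in> M \<longleftrightarrow> (\<exists>x. x \<in> nat_zeros m W a)))"

definition finite_fold :: "nat \<Rightarrow> nat \<Rightarrow> int_mpoly \<Rightarrow> bool" where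
  "finite_fold k m W \<longleftrightarrow> (\<forall>a. length a = k \<longrightarrow> finite (nat_zeros m W a))"

definition graph_on :: "nat set \<Rightarrow> (nat \<Rightarrow> nat) \<Rightarrow> nat list set" where
  "graph_on D f = {[n, f n] | n. n \<in> D}"

end

theory Submission
  imports Defs "HOL-Computational_Algebra.Primes"
begin

text \<open>Suppose \<open>W\<close> is a finite-fold representation of \<open>g\<close>. Writing every natural number as a
  sum of four integer squares (in finitely many ways), the conditions \<open>x = 2 ^ j\<close>,
  \<open>W(x, u + v, z\<^sub>1, \<dots>, z\<^sub>m) = 0\<close> become a system of elementary equations over the integers in
  \<open>j + C\<close> variables, where \<open>C\<close> depends on \<open>W\<close> only. It has finitely many solutions, but at
  least \<open>g (2 ^ j) + 1\<close> of them, one for each splitting \<open>g (2 ^ j) = u + v\<close>. For large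
  \<open>j\<close> we have \<open>j + C \<le> 2 ^ j\<close>, so after padding with variables equal to \<open>1\<close> this
  contradicts the maximality of \<open>g (2 ^ j)\<close>.\<close>

section \<open>Lagrange's four-square theorem\<close>

definition four_squares :: "int \<Rightarrow> bool" where
  "four_squares n \<longleftrightarrow> (\<exists>a b c d. n = a^2 + b^2 + c^2 + d^2)"

text \<open>Euler's identity, with signs chosen so that the last three squared terms vanish when the
  two quadruples coincide; the descent relies on this modulo \<open>m\<close>.\<close>

lemma euler_four_squares:
  fixes a b c d e f g h :: "'a :: comm_ring_1"
  shows "(a^2 + b^2 + c^2 + d^2) * (e^2 + f^2 + g^2 + h^2) =
    (a*e + b*f + c*g + d*h)^2 + (a*f - b*e + c*h - d*g)^2 +
    (a*g - b*h - c*e + d*f)^2 + (a*h + b*g - c*f - d*e)^2"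
  by (simp add: algebra_simps power2_eq_square)

lemma four_squares_mult:
  assumes "four_squares m" "four_squares n"
  shows "four_squares (m * n)"
  using assms unfolding four_squares_def by (metis euler_four_squares)

text \<open>Pigeonhole: with \<open>p = 2 * r + 1\<close>, the values \<open>x^2\<close> and
  \<open>- 1 - y^2\<close> for arguments in \<open>{0..r}\<close> give two sets of
  \<open>r + 1\<close> residues each, too many to be disjoint modulo \<open>p\<close>.\<close>

lemma prime_dvd_two_squares_plus_one:
  fixes p :: int
  assumes "prime p" "odd p"
  obtains x y where "p dvd x^2 + y^2 + 1" "0 \<le> x" "2 * x < p" "0 \<le> y" "2 * y < p"
proof -
  define r where "r = (p - 1) div 2"
  have r: "p = 2 * r + 1" using \<open>odd p\<close> by (auto simp: r_def elim!: oddE)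
  have "p > 1" using assms prime_gt_1_int by blast
  define A where "A = (\<lambda>x. x^2 mod p) ` {0..r}"
  define B where "B = (\<lambda>y. (- 1 - y^2) mod p) ` {0..r}"
  have sq: "x = y" if "x \<in> {0..r}" "y \<in> {0..r}" "p dvd x^2 - y^2" for x y
  proof -
    have "p dvd (x - y) * (x + y)" using that(3) by (simp add: algebra_simps power2_eq_square)
    then consider "p dvd x - y" | "p dvd x + y" using prime_dvd_multD[OF assms(1)] by blast
    then show ?thesis
    proof cases
      case 1
      have "\<bar>x - y\<bar> < p" using that r by auto
      then show ?thesis using 1 \<open>p > 1\<close> dvd_imp_le_int[of "x - y" p] by auto
    next
      case 2
      then have "x + y = 0" using that r zdvd_imp_le[of p "x + y"] by force
      then show ?thesis using that by auto
    qed
  qed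
  have "inj_on (\<lambda>x. x^2 mod p) {0..r}"
    by (intro inj_onI sq) (auto simp: mod_eq_dvd_iff)
  then have cA: "card A = nat (r + 1)" by (simp add: A_def card_image)
  have "inj_on (\<lambda>y. (- 1 - y^2) mod p) {0..r}"
    by (intro inj_onI sq) (auto simp: mod_eq_dvd_iff dvd_diff_commute)
  then have cB: "card B = nat (r + 1)" by (simp add: B_def card_image)
  have sub: "A \<union> B \<subseteq> {0..<p}" using \<open>p > 1\<close> by (auto simp: A_def B_def)
  have "A \<inter> B \<noteq> {}"
  proof
    assume "A \<inter> B = {}"
    then have "card (A \<union> B) = card A + card B"
      by (intro card_Un_disjoint) (auto simp: A_def B_def)
    moreover have "card (A \<union> B) \<le> card {0..<p}" using sub by (intro card_mono) auto
    ultimately show False using cA cB r \<open>p > 1\<close> by simp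
  qed
  then obtain x y where xy: "x \<in> {0..r}" "y \<in> {0..r}" "x^2 mod p = (- 1 - y^2) mod p"
    unfolding A_def B_def by blast
  then have "p dvd x^2 - (- 1 - y^2)" by (simp add: mod_eq_dvd_iff)
  then have "p dvd x^2 + y^2 + 1" by (simp add: algebra_simps)
  then show thesis using that xy r by auto
qed

text \<open>The interval is half-open on purpose: a residue with \<open>2 * y = - m\<close> is
  excluded, so \<open>(2 * y)^2 = m^2\<close> leaves only \<open>2 * y = m\<close>.\<close>

lemma balanced_residue:
  fixes m x :: int
  assumes "m > 0"
  obtains y where "m dvd x - y" "- m < 2 * y" "2 * y \<le> m"
proof (cases "2 * (x mod m) \<le> m")
  case True
  show thesis
    by (rule that[of "x mod m"]) (use True assms in \<open>auto simp: minus_mod_eq_mult_div intro: order.strict_trans2[of _ 0]\<close>)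
next
  case False
  have "m dvd x - x mod m + m" by (simp add: minus_mod_eq_mult_div)
  moreover have "x mod m < m" using assms by simp
  ultimately show thesis using False by (intro that[of "x mod m - m"]) (auto simp: algebra_simps)
qed

text \<open>Reduce the four squares modulo \<open>m\<close> to residues of absolute value at most \<open>m / 2\<close>; their
  squares sum to \<open>m * r\<close>, and all four terms of Euler's identity for the product of
  \<open>m * p\<close> and \<open>m * r\<close> are divisible by \<open>m\<close>. Both \<open>r = 0\<close> and
  \<open>r = m\<close> would force \<open>m\<^sup>2\<close> to divide \<open>m * p\<close>.\<close>

lemma four_squares_descent:
  fixes p m :: int
  assumes "prime p" "1 < m" "m < p" "four_squares (m * p)"
  obtains r where "0 < r" "r < m" "four_squares (r * p)"
proof -
  obtain a b c d where abcd: "m * p = a^2 + b^2 + c^2 + d^2"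
    using assms(4) unfolding four_squares_def by auto
  have not_dvd: "\<not> m^2 dvd m * p"
  proof
    assume "m^2 dvd m * p"
    then have "m dvd p" using assms(2) by (simp add: power2_eq_square)
    then have "m = 1 \<or> m = p" using assms(1,2) unfolding prime_int_iff by (auto dest: spec[of _ m])
    then show False using assms(2,3) by simp
  qed
  have "m > 0" using assms by simp
  obtain e where e: "m dvd a - e" "- m < 2 * e" "2 * e \<le> m" using balanced_residue[OF \<open>m > 0\<close>] .
  obtain f where f: "m dvd b - f" "- m < 2 * f" "2 * f \<le> m" using balanced_residue[OF \<open>m > 0\<close>] .
  obtain g where g: "m dvd c - g" "- m < 2 * g" "2 * g \<le> m" using balanced_residue[OF \<open>m > 0\<close>] .
  obtain h where h: "m dvd d - h" "- m < 2 * h" "2 * h \<le> m" using balanced_residue[OF \<open>m > 0\<close>] .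
  obtain a' b' c' d' where q: "a = e + m * a'" "b = f + m * b'" "c = g + m * c'" "d = h + m * d'"
    using e(1) f(1) g(1) h(1) unfolding dvd_def by (metis diff_add_cancel add.commute)
  define r where "r = p - m * (a'^2 + b'^2 + c'^2 + d'^2) - 2 * (e*a' + f*b' + g*c' + h*d')"
  have mr: "m * r = e^2 + f^2 + g^2 + h^2"
    using abcd unfolding r_def q by (simp add: algebra_simps power2_eq_square)
  have bnd: "4 * t^2 \<le> m^2" if "- m < 2 * t" "2 * t \<le> m" for t
  proof -
    have "\<bar>2 * t\<bar> \<le> \<bar>m\<bar>" using that by linarith
    then show ?thesis unfolding abs_le_square_iff by (simp add: power_mult_distrib)
  qed
  note bnds = bnd[OF e(2,3)] bnd[OF f(2,3)] bnd[OF g(2,3)] bnd[OF h(2,3)]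
  have "m * r \<le> m * m" using bnds mr by (simp add: power2_eq_square)
  then have "r \<le> m" using \<open>m > 0\<close> by simp
  have "m * r \<ge> 0" using mr by simp
  then have "r \<ge> 0" using \<open>m > 0\<close> by (simp add: zero_le_mult_iff)
  have "r \<noteq> 0"
  proof
    assume "r = 0"
    then have "e^2 + f^2 + g^2 + h^2 = 0" using mr by simp
    then have "e = 0 \<and> f = 0 \<and> g = 0 \<and> h = 0"
      by (simp add: add_nonneg_eq_0_iff)
    then have "m * p = m^2 * (a'^2 + b'^2 + c'^2 + d'^2)"
      using abcd q by (simp add: algebra_simps power_mult_distrib)
    then show False using not_dvd by simp
  qed
  moreover have "r \<noteq> m"
  proof
    assume "r = m"
    then have "e^2 + f^2 + g^2 + h^2 = m^2" using mr by (simp add: power2_eq_square)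
    \<comment> \<open>Four terms, each at most \<open>m^2\<close>, sum to \<open>4 * m^2\<close>, so
      every bound is attained.\<close>
    then have eq: "(2*e)^2 = m^2" "(2*f)^2 = m^2" "(2*g)^2 = m^2" "(2*h)^2 = m^2"
      using bnds by (simp_all add: power_mult_distrib)
    have "2 * e = m" "2 * f = m" "2 * g = m" "2 * h = m"
      using eq[unfolded power2_eq_iff] e f g h by auto
    then have "m = 2 * e" "f = e" "g = e" "h = e" by auto
    then have "m * p = m^2 * (a'^2 + b'^2 + c'^2 + d'^2 + a' + b' + c' + d' + 1)"
      using abcd q by (simp add: algebra_simps power2_eq_square)
    then show False using not_dvd by simp
  qed
  ultimately have r: "0 < r" "r < m" using \<open>r \<ge> 0\<close> \<open>r \<le> m\<close> by auto
  \<comment> \<open>Quotients by \<open>m\<close> of the four terms in Euler's identity: after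
    substituting \<open>q\<close>, the parts free of \<open>m\<close> add up to \<open>m * r\<close>
    in the first term and cancel in the others.\<close>
  define s t u v where "s = r + a'*e + b'*f + c'*g + d'*h" and "t = a'*f - b'*e + c'*h - d'*g"
    and "u = a'*g - b'*h - c'*e + d'*f" and "v = a'*h + b'*g - c'*f - d'*e"
  have "a*e + b*f + c*g + d*h = m * s"
    using mr unfolding q s_def by (simp add: algebra_simps power2_eq_square)
  moreover have "a*f - b*e + c*h - d*g = m * t" "a*g - b*h - c*e + d*f = m * u"
    "a*h + b*g - c*f - d*e = m * v"
    unfolding q t_def u_def v_def by (simp_all add: algebra_simps)
  ultimately have "(m * p) * (m * r) = (m*s)^2 + (m*t)^2 + (m*u)^2 + (m*v)^2"
    unfolding abcd mr euler_four_squares by simp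
  then have "m^2 * (r * p) = m^2 * (s^2 + t^2 + u^2 + v^2)"
    by (simp add: algebra_simps power2_eq_square)
  then have "r * p = s^2 + t^2 + u^2 + v^2" using \<open>m > 0\<close> by simp
  then have "four_squares (r * p)" unfolding four_squares_def by blast
  then show thesis using that r by blast
qed

lemma four_squares_prime:
  fixes p :: int
  assumes "prime p"
  shows "four_squares p"
proof (cases "p = 2")
  case True
  have "(2::int) = 1^2 + 1^2 + 0^2 + 0^2" by simp
  then show ?thesis unfolding True four_squares_def by blast
next
  case False
  then have "odd p" using assms by (metis prime_int_numeral_eq primes_dvd_imp_eq two_is_prime_nat)
  then obtain x y where xy: "p dvd x^2 + y^2 + 1" "0 \<le> x" "2 * x < p" "0 \<le> y" "2 * y < p"
    using prime_dvd_two_squares_plus_one[OF assms] by blast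
  obtain k where k: "x^2 + y^2 + 1 = p * k" using xy(1) by (rule dvdE)
  have "p > 1" using assms prime_gt_1_int by blast
  \<comment> \<open>Altogether \<open>4 * (p * k) < 2 * p^2 + 4 \<le> 3 * p^2\<close>, so the
    descent starts from a factor \<open>k\<close> below \<open>p\<close>.\<close>
  have "(2*x)^2 < p^2" "(2*y)^2 < p^2" by (rule power_strict_mono; use xy in simp)+
  moreover have "p * p \<ge> 2 * 2" using \<open>p > 1\<close> by (intro mult_mono) auto
  ultimately have "p * k < p * p" using k by (simp add: power2_eq_square)
  then have "k < p" using \<open>p > 1\<close> by simp
  have "p * k > 0" using k by (metis add.commute add_nonneg_pos sum_power2_ge_zero zero_less_one)
  then have "k > 0" using \<open>p > 1\<close> by (simp add: zero_less_mult_iff)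
  have "k * p = x^2 + y^2 + 1^2 + 0^2" using k by (simp add: mult.commute)
  then have "four_squares (k * p)" unfolding four_squares_def by blast
  then show ?thesis using \<open>0 < k\<close> \<open>k < p\<close>
  proof (induction "nat k" arbitrary: k rule: less_induct)
    case less
    show ?case
    proof (cases "k = 1")
      case False
      then obtain r where "0 < r" "r < k" "four_squares (r * p)"
        using four_squares_descent[OF assms, of k] less.prems by auto
      then show ?thesis using less by auto
    qed (use less in simp)
  qed
qed

lemma four_squares_nonneg:
  assumes "n \<ge> 0"
  shows "four_squares n"
  using assms
proof (induction n rule: prime_divisors_induct)
  case zero
  have "(0::int) = 0^2 + 0^2 + 0^2 + 0^2" by simp
  then show ?case unfolding four_squares_def by blast
next
  case (unit x)
  then have "x = 1^2 + 0^2 + 0^2 + 0^2" by auto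
  then show ?case unfolding four_squares_def by blast
next
  case (factor p x)
  then have "p > 0" using prime_gt_0_int by blast
  then have "x \<ge> 0" using factor.prems by (simp add: zero_le_mult_iff)
  then show ?case using factor by (auto intro: four_squares_mult four_squares_prime)
qed

section \<open>Polynomial functions as systems of elementary equations\<close>

lemma E_mono: "n \<le> m \<Longrightarrow> E n \<subseteq> E m"
  unfolding E_def by auto

lemma satisfies_cong:
  assumes "e \<in> E n" "\<And>i. i \<in> {1..n} \<Longrightarrow> x i = y i"
  shows "satisfies x e \<longleftrightarrow> satisfies y e"
  using assms(1) unfolding E_def by (auto simp: assms(2))

definition sat :: "equation set \<Rightarrow> (nat \<Rightarrow> int) \<Rightarrow> bool" where
  "sat S x \<longleftrightarrow> (\<forall>e\<in>S. satisfies x e)"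

lemma sat_Un [simp]: "sat (S \<union> T) x \<longleftrightarrow> sat S x \<and> sat T x"
  and sat_insert [simp]: "sat (insert e S) x \<longleftrightarrow> satisfies x e \<and> sat S x"
  and sat_empty [simp]: "sat {} x"
  by (auto simp: sat_def)

lemma sat_cong:
  assumes "S \<subseteq> E n" "\<And>i. i \<in> {1..n} \<Longrightarrow> x i = y i"
  shows "sat S x \<longleftrightarrow> sat S y"
  using assms satisfies_cong[of _ n x y] unfolding sat_def by blast

text \<open>\<open>extends n n' S\<close>: the system \<open>S\<close> determines the variables \<open>n + 1, \<dots>, n'\<close> as
  functions of \<open>1, \<dots>, n\<close> without constraining the latter.\<close>

definition extends :: "nat \<Rightarrow> nat \<Rightarrow> equation set \<Rightarrow> bool" where
  "extends n n' S \<longleftrightarrow> S \<subseteq> E n' \<and>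
     (\<forall>x. \<exists>y. (\<forall>i\<in>{1..n}. y i = x i) \<and> sat S y) \<and>
     (\<forall>y y'. sat S y \<longrightarrow> sat S y' \<longrightarrow> (\<forall>i\<in>{1..n}. y i = y' i) \<longrightarrow> (\<forall>i\<in>{1..n'}. y i = y' i))"

lemma extends_refl: "extends n n {}"
  unfolding extends_def by auto

lemma extends_trans:
  assumes S: "extends n n' S" and T: "extends n' n'' T" and "n \<le> n'" "n' \<le> n''"
  shows "extends n n'' (S \<union> T)"
  unfolding extends_def
proof (intro conjI allI impI)
  show "S \<union> T \<subseteq> E n''" using assms E_mono[of n' n''] unfolding extends_def by blast
next
  fix x :: "nat \<Rightarrow> int"
  obtain y where y: "\<forall>i\<in>{1..n}. y i = x i" "sat S y" using S unfolding extends_def by blast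
  obtain z where z: "\<forall>i\<in>{1..n'}. z i = y i" "sat T z" using T unfolding extends_def by blast
  \<comment> \<open>\<open>S\<close> mentions only variables up to \<open>n'\<close>, where
    \<open>z\<close> and \<open>y\<close> agree.\<close>
  have "sat S z" using sat_cong[of S n' z y] y z S unfolding extends_def by blast
  moreover have "\<forall>i\<in>{1..n}. z i = x i" using y z \<open>n \<le> n'\<close> by auto
  ultimately show "\<exists>y. (\<forall>i\<in>{1..n}. y i = x i) \<and> sat (S \<union> T) y" using z by auto
next
  fix y y'
  assume *: "sat (S \<union> T) y" "sat (S \<union> T) y'" "\<forall>i\<in>{1..n}. y i = y' i"
  then have "\<forall>i\<in>{1..n'}. y i = y' i" using S unfolding extends_def by simp
  then show "\<forall>i\<in>{1..n''}. y i = y' i" using * T unfolding extends_def by simp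
qed

text \<open>The last hypothesis says that \<open>op\<close> reads only the first \<open>n\<close>
  variables, so assigning its value to variable \<open>n + 1\<close> cannot change that
  value.\<close>

lemma extends_gate:
  assumes "f \<in> E (Suc n)" "\<And>x. satisfies x f \<longleftrightarrow> x (Suc n) = op x"
    and "\<And>x y. (\<And>i. i \<in> {1..n} \<Longrightarrow> x i = y i) \<Longrightarrow> op x = op y"
  shows "extends n (Suc n) {f}"
  unfolding extends_def
proof (intro conjI allI impI)
  fix x :: "nat \<Rightarrow> int"
  have "op (x(Suc n := op x)) = op x" by (rule assms(3)) auto
  then show "\<exists>y. (\<forall>i\<in>{1..n}. y i = x i) \<and> sat {f} y"
    by (intro exI[of _ "x(Suc n := op x)"]) (auto simp: assms(2))
next
  fix y y'
  assume *: "sat {f} y" "sat {f} y'" "\<forall>i\<in>{1..n}. y i = y' i"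
  then have "op y = op y'" by (intro assms(3)) auto
  with * show "\<forall>i\<in>{1..Suc n}. y i = y' i" by (auto simp: assms(2) le_Suc_eq)
qed (use assms(1) in simp)

text \<open>\<open>F\<close> is realised with a number \<open>c\<close> of auxiliary variables that does not depend on where
  they are placed.\<close>

definition computes :: "nat \<Rightarrow> ((nat \<Rightarrow> int) \<Rightarrow> int) \<Rightarrow> bool" where
  "computes d F \<longleftrightarrow> (\<exists>c. \<forall>n\<ge>d. \<exists>S out. extends n (n + c) S \<and> out \<in> {1..n + c} \<and>
     (\<forall>y. sat S y \<longrightarrow> y out = F y))"

lemma computes_proj:
  assumes "i \<in> {1..d}"
  shows "computes d (\<lambda>x. x i)"
  unfolding computes_def
proof (intro exI[of _ 0] allI impI)
  fix n
  assume "d \<le> n"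
  then show "\<exists>S out. extends n (n + 0) S \<and> out \<in> {1..n + 0} \<and> (\<forall>y. sat S y \<longrightarrow> y out = y i)"
    using assms by (intro exI[of _ "{}"] exI[of _ i]) (auto simp: extends_refl)
qed

lemma computes_one: "computes d (\<lambda>x. 1)"
  unfolding computes_def
proof (intro exI[of _ 1] allI impI)
  fix n
  have "extends n (Suc n) {One_eq (Suc n)}"
    by (rule extends_gate[where op = "\<lambda>x. 1"]) (auto simp: E_def)
  then show "\<exists>S out. extends n (n + 1) S \<and> out \<in> {1..n + 1} \<and> (\<forall>y. sat S y \<longrightarrow> y out = 1)"
    by (intro exI[of _ "{One_eq (Suc n)}"] exI[of _ "Suc n"]) auto
qed

text \<open>The auxiliary variables of \<open>G\<close> are stacked above those of \<open>F\<close>,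
  which is possible because \<open>computes\<close> allows any starting point
  \<open>n \<ge> d\<close>; one more variable holds the result.\<close>

lemma computes_gate:
  assumes F: "computes d F" and G: "computes d G"
    and f: "\<And>n i j k. i \<in> {1..n} \<Longrightarrow> j \<in> {1..n} \<Longrightarrow> k \<in> {1..n} \<Longrightarrow> f i j k \<in> E n"
    and op: "\<And>x i j k. satisfies x (f i j k) \<longleftrightarrow> x k = op (x i) (x j)"
  shows "computes d (\<lambda>x. op (F x) (G x))"
proof -
  obtain c where c: "\<And>n. n \<ge> d \<Longrightarrow> \<exists>S out. extends n (n + c) S \<and> out \<in> {1..n + c} \<and>
     (\<forall>y. sat S y \<longrightarrow> y out = F y)" using F unfolding computes_def by blast
  obtain c' where c': "\<And>n. n \<ge> d \<Longrightarrow> \<exists>S out. extends n (n + c') S \<and> out \<in> {1..n + c'} \<and>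
     (\<forall>y. sat S y \<longrightarrow> y out = G y)" using G unfolding computes_def by blast
  show ?thesis unfolding computes_def
  proof (intro exI[of _ "Suc (c + c')"] allI impI)
    fix n assume n: "d \<le> n"
    define l where "l = n + c + c'"
    obtain S i where S: "extends n (n + c) S" "i \<in> {1..n + c}" "\<And>y. sat S y \<Longrightarrow> y i = F y"
      using c[OF n] by blast
    obtain T j where T: "extends (n + c) l T" "j \<in> {1..l}" "\<And>y. sat T y \<Longrightarrow> y j = G y"
      using c'[of "n + c"] n unfolding l_def by auto
    have i: "i \<in> {1..l}" using S unfolding l_def by auto
    have U: "extends l (Suc l) {f i j (Suc l)}"
      by (rule extends_gate[where op = "\<lambda>x. op (x i) (x j)"])
        (use T(2) i in \<open>auto simp: op intro!: f\<close>)
    have "extends n l (S \<union> T)"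
      by (rule extends_trans[OF S(1) T(1)]) (simp_all add: l_def)
    then have R: "extends n (Suc l) (S \<union> T \<union> {f i j (Suc l)})"
      by (rule extends_trans[OF _ U]) (simp_all add: l_def)
    have "y (Suc l) = op (F y) (G y)" if "sat (S \<union> T \<union> {f i j (Suc l)}) y" for y
      using that S(3)[of y] T(3)[of y] by (simp add: op)
    with R show "\<exists>S out. extends n (n + Suc (c + c')) S \<and> out \<in> {1..n + Suc (c + c')} \<and>
        (\<forall>y. sat S y \<longrightarrow> y out = op (F y) (G y))"
      by (intro exI[of _ "S \<union> T \<union> {f i j (Suc l)}"] exI[of _ "Suc l"])
        (simp add: l_def add.assoc)
  qed
qed

lemma computes_add:
  assumes "computes d F" "computes d G"
  shows "computes d (\<lambda>x. F x + G x)"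
  by (rule computes_gate[where f = Add_eq, OF assms]) (auto simp: E_def)

lemma computes_diff:
  assumes "computes d F" "computes d G"
  shows "computes d (\<lambda>x. F x - G x)"
  \<comment> \<open>An addition read backwards: the new variable is a summand, not the sum.\<close>
  by (rule computes_gate[where f = "\<lambda>i j k. Add_eq k j i", OF assms]) (auto simp: E_def)

lemma computes_mult:
  assumes "computes d F" "computes d G"
  shows "computes d (\<lambda>x. F x * G x)"
  by (rule computes_gate[where f = Mult_eq, OF assms]) (auto simp: E_def)

lemma computes_const: "computes d (\<lambda>x. a)"
proof (induction a rule: int_induct[of _ 1])
  case base
  show ?case by (rule computes_one)
next
  case (step1 i)
  then show ?case by (intro computes_add computes_one)
next
  case (step2 i)
  then show ?case by (intro computes_diff computes_one)
qed

lemma computes_power: "computes d F \<Longrightarrow> computes d (\<lambda>x. F x ^ n)"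
  by (induction n) (auto intro: computes_one computes_mult)

lemma computes_sum:
  assumes "\<And>i. i \<in> A \<Longrightarrow> computes d (F i)"
  shows "computes d (\<lambda>x. \<Sum>i\<in>A. F i x)"
  using assms
  by (induction A rule: infinite_finite_induct) (auto intro: computes_const computes_add)

lemma computes_prod:
  assumes "\<And>i. i \<in> A \<Longrightarrow> computes d (F i)"
  shows "computes d (\<lambda>x. \<Prod>i\<in>A. F i x)"
  using assms
  by (induction A rule: infinite_finite_induct) (auto intro: computes_one computes_mult)

lemma computes_eval_poly:
  assumes "\<And>i. i \<in> vars W \<Longrightarrow> computes d (F i)"
  shows "computes d (\<lambda>x. eval_poly W (\<lambda>i. F i x))"
  unfolding eval_poly_def
  by (intro computes_sum computes_mult computes_const computes_prod computes_power assms)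
    (auto simp: vars_def)

lemma eval_poly_cong:
  assumes "\<And>i. i \<in> vars W \<Longrightarrow> v i = w i"
  shows "eval_poly W v = eval_poly W w"
  unfolding eval_poly_def
proof (intro sum.cong refl arg_cong2[of _ _ _ _ "(*)"] prod.cong)
  fix t i
  assume "t \<in> Poly_Mapping.keys W" "i \<in> Poly_Mapping.keys t"
  then have "i \<in> vars W" by (auto simp: vars_def)
  then show "v i ^ Poly_Mapping.lookup t i = w i ^ Poly_Mapping.lookup t i"
    by (simp add: assms)
qed

text \<open>Start from 1 and double \<open>j\<close> times. The variable \<open>n + 1\<close>, equal
  to 1, is kept in the statement because it later serves to express an equality of two
  variables.\<close>

lemma extends_power2:
  "\<exists>S. extends n (n + Suc j) S \<and> (\<forall>y. sat S y \<longrightarrow> y (n + 1) = 1 \<and> y (n + Suc j) = 2 ^ j)"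
proof (induction j)
  case 0
  have "extends n (n + 1) {One_eq (n + 1)}"
    using extends_gate[where op = "\<lambda>x. 1" and n = n and f = "One_eq (n + 1)"] by (auto simp: E_def)
  then show ?case by (intro exI[of _ "{One_eq (n + 1)}"]) auto
next
  case (Suc j)
  define k where "k = n + Suc j"
  obtain S where S: "extends n k S" "\<And>y. sat S y \<Longrightarrow> y (n + 1) = 1 \<and> y k = 2 ^ j"
    using Suc unfolding k_def by blast
  have "extends k (Suc k) {Add_eq k k (Suc k)}"
    by (rule extends_gate[where op = "\<lambda>x. x k + x k"]) (auto simp: E_def k_def)
  with S have "extends n (Suc k) (S \<union> {Add_eq k k (Suc k)})"
    by (intro extends_trans[where n' = k]) (auto simp: k_def)
  moreover have "y (n + 1) = 1 \<and> y (Suc k) = 2 ^ Suc j" if "sat (S \<union> {Add_eq k k (Suc k)}) y" for y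
    using S(2)[of y] that by auto
  ultimately show ?case unfolding k_def by (intro exI) auto
qed

text \<open>Padding variables are pinned to 1, since free ones would make a nonempty solution set
  infinite.\<close>

lemma extends_pad: "n \<le> n' \<Longrightarrow> \<exists>S. extends n n' S"
proof (induction rule: dec_induct)
  case base
  show ?case using extends_refl by blast
next
  case (step k)
  have "extends k (Suc k) {One_eq (Suc k)}"
    by (rule extends_gate[where op = "\<lambda>x. 1"]) (auto simp: E_def)
  moreover obtain S where "extends n k S" using step by blast
  ultimately have "extends n (Suc k) (S \<union> {One_eq (Suc k)})"
    using step by (intro extends_trans[where n' = k]) auto
  then show ?case by blast
qed

section \<open>The diagonal argument\<close>

lemma solutions_eq: "solutions n S = {x \<in> {1..n} \<rightarrow>\<^sub>E UNIV. sat S x}"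
  by (simp add: solutions_def sat_def)

text \<open>Since \<open>2 ^ j\<close> is built by \<open>j\<close> doublings, the number of variables grows only linearly
  in \<open>j\<close>.\<close>

lemma system_for_zeros:
  assumes F: "computes d F" and d: "d \<ge> 1"
    and cong: "\<And>x y. (\<And>i. i \<in> {1..d} \<Longrightarrow> x i = y i) \<Longrightarrow> F x = F y"
  shows "\<exists>C. \<forall>j N. C + j \<le> N \<longrightarrow> (\<exists>S\<subseteq>E N. bij_betw (\<lambda>y. restrict y {1..d}) (solutions N S)
           {x \<in> {1..d} \<rightarrow>\<^sub>E UNIV. x 1 = 2 ^ j \<and> F x = 0})"
proof -
  obtain c where c: "\<And>n. n \<ge> d \<Longrightarrow> \<exists>S out. extends n (n + c) S \<and> out \<in> {1..n + c} \<and>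
     (\<forall>y. sat S y \<longrightarrow> y out = F y)" using F unfolding computes_def by blast
  have "\<exists>S\<subseteq>E N. bij_betw (\<lambda>y. restrict y {1..d}) (solutions N S)
      {x \<in> {1..d} \<rightarrow>\<^sub>E UNIV. x 1 = 2 ^ j \<and> F x = 0}" if N: "(d + 1 + c) + j \<le> N" for j N
  proof -
    define n where "n = d + Suc j"
    obtain S1 where S1: "extends d n S1" "\<And>y. sat S1 y \<Longrightarrow> y (d + 1) = 1 \<and> y n = 2 ^ j"
      using extends_power2[of d j] unfolding n_def by blast
    obtain S2 out where S2: "extends n (n + c) S2" "out \<in> {1..n + c}" "\<And>y. sat S2 y \<Longrightarrow> y out = F y"
      using c[of n] unfolding n_def by auto
    have nN: "n + c \<le> N" using N by (simp add: n_def)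
    obtain S3 where S3: "extends (n + c) N S3" using extends_pad[OF nN] by blast
    define T where "T = S1 \<union> (S2 \<union> S3)"
    have "extends n N (S2 \<union> S3)" by (rule extends_trans[OF S2(1) S3]) (use nN in simp_all)
    then have T: "extends d N T" unfolding T_def
      by (rule extends_trans[OF S1(1)]) (use nN in \<open>simp_all add: n_def\<close>)
    have TE: "T \<subseteq> E N" using T unfolding extends_def by blast
    have T_out: "y (d + 1) = 1" "y n = 2 ^ j" "y out = F y" if "sat T y" for y
      using that S1(2)[of y] S2(3)[of y] by (auto simp: T_def)
    \<comment> \<open>With variable \<open>d + 1\<close> equal to 1, the product says that variable
      1 equals variable \<open>n\<close>, that is \<open>2 ^ j\<close>;
      \<open>out + out = out\<close> says that \<open>F\<close> vanishes.\<close>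
    define S where "S = insert (Mult_eq 1 (d + 1) n) (insert (Add_eq out out out) T)"
    have S_iff: "sat S y \<longleftrightarrow> sat T y \<and> y 1 = 2 ^ j \<and> F y = 0" for y
      using T_out[of y] unfolding S_def sat_insert satisfies.simps by auto
    have SE: "S \<subseteq> E N"
      using TE nN S2(2) unfolding S_def by (auto simp: E_def n_def)
    have Fr: "F (restrict y {1..m}) = F y" if "d \<le> m" for y m
      using that by (intro cong) auto
    have dN: "d \<le> N" using N by simp
    have "bij_betw (\<lambda>y. restrict y {1..d}) (solutions N S)
      {x \<in> {1..d} \<rightarrow>\<^sub>E UNIV. x 1 = 2 ^ j \<and> F x = 0}"
      unfolding bij_betw_def
    proof (intro conjI inj_onI equalityI subsetI)
      fix y y'
      assume *: "y \<in> solutions N S" "y' \<in> solutions N S" "restrict y {1..d} = restrict y' {1..d}"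
      then have "\<forall>i\<in>{1..d}. y i = y' i" by (metis restrict_apply')
      then have "\<forall>i\<in>{1..N}. y i = y' i"
        using T * unfolding extends_def solutions_eq S_iff by blast
      then show "y = y'" using * unfolding solutions_eq by (auto intro: PiE_ext)
    next
      fix x
      assume "x \<in> (\<lambda>y. restrict y {1..d}) ` solutions N S"
      then obtain y where "sat S y" "x = restrict y {1..d}" unfolding solutions_eq by blast
      then show "x \<in> {x \<in> {1..d} \<rightarrow>\<^sub>E UNIV. x 1 = 2 ^ j \<and> F x = 0}"
        using d Fr[of d y] by (auto simp: S_iff)
    next
      fix x
      assume x: "x \<in> {x \<in> {1..d} \<rightarrow>\<^sub>E UNIV. x 1 = 2 ^ j \<and> F x = 0}"
      obtain y where y: "\<forall>i\<in>{1..d}. y i = x i" "sat T y" using T unfolding extends_def by blast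
      define y' where "y' = restrict y {1..N}"
      have "sat T y'" using sat_cong[OF TE, of y' y] y(2) by (simp add: y'_def)
      moreover have "F y' = F x" using y(1) dN unfolding y'_def by (intro cong) auto
      moreover have "y' 1 = x 1" using y(1) d dN by (simp add: y'_def)
      ultimately have "y' \<in> solutions N S" using x unfolding solutions_eq S_iff by (simp add: y'_def)
      moreover have "x = restrict y' {1..d}"
        using x y(1) dN by (auto simp: y'_def fun_eq_iff PiE_iff extensional_def)
      ultimately show "x \<in> (\<lambda>y. restrict y {1..d}) ` solutions N S" by blast
    qed
    with SE show ?thesis by blast
  qed
  then show ?thesis by blast
qed

section \<open>Coding natural arguments by sums of four integer squares\<close>

text \<open>Variable 1 is left for the parameter and block \<open>i\<close> occupies variables
  \<open>4 * i + 2\<close> to \<open>4 * i + 5\<close>. Blocks \<open>0\<close> to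
  \<open>m + 1\<close> therefore end at variable \<open>4 * m + 9\<close>.\<close>

definition square_block :: "(nat \<Rightarrow> int) \<Rightarrow> nat \<Rightarrow> int" where
  "square_block x i = (\<Sum>r<4. x (4 * i + 2 + r) ^ 2)"

text \<open>The parameter \<open>n\<close> is variable \<open>1\<close>; the value \<open>g n\<close> is split as a sum of two
  naturals, which produces \<open>g n + 1\<close> different solutions.\<close>

definition args :: "(nat \<Rightarrow> int) \<Rightarrow> nat \<Rightarrow> int" where
  "args x i = (if i = 0 then x 1 else if i = 1 then square_block x 0 + square_block x 1
     else square_block x i)"

lemma square_block_cong:
  assumes "\<And>i. i \<in> {1..4 * m + 9} \<Longrightarrow> x i = y i" "i < m + 2"
  shows "square_block x i = square_block y i"
  unfolding square_block_def using assms by (intro sum.cong) auto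

lemma square_block_nonneg: "square_block x i \<ge> 0"
  unfolding square_block_def by (intro sum_nonneg) simp

text \<open>Every variable from 2 on lies in some block, so bounds on the blocks bound all these
  variables; this yields finiteness.\<close>

lemma abs_le_square_block:
  assumes "t \<ge> 2"
  shows "\<bar>x t\<bar> \<le> square_block x ((t - 2) div 4)"
proof -
  have t: "t = 4 * ((t - 2) div 4) + 2 + (t - 2) mod 4" using assms by presburger
  have "\<bar>x t\<bar> \<le> (x t)^2"
    using self_le_power[of "\<bar>x t\<bar>" 2] by (cases "x t = 0") auto
  also have "\<dots> \<le> square_block x ((t - 2) div 4)"
    unfolding square_block_def
    using member_le_sum[of "(t - 2) mod 4" "{..<4}" "\<lambda>r. x (4 * ((t - 2) div 4) + 2 + r) ^ 2"] t
    by simp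
  finally show ?thesis .
qed

lemma exists_square_blocks:
  fixes z :: "nat \<Rightarrow> nat"
  obtains x where "x 1 = a" "\<And>i. square_block x i = int (z i)"
proof -
  have "\<exists>w :: nat \<Rightarrow> int. (\<Sum>r<4. w r ^ 2) = int n" for n
  proof -
    obtain a b c d where "int n = a^2 + b^2 + c^2 + d^2"
      using four_squares_nonneg[of "int n"] unfolding four_squares_def by auto
    then show ?thesis
      by (intro exI[of _ "\<lambda>r. [a, b, c, d] ! r"]) (simp add: eval_nat_numeral)
  qed
  then obtain w :: "nat \<Rightarrow> nat \<Rightarrow> int" where w: "\<And>n. (\<Sum>r<4. w n r ^ 2) = int n" by metis
  define x where "x t = (if t = 1 then a else w (z ((t - 2) div 4)) ((t - 2) mod 4))" for t
  have "square_block x i = int (z i)" for i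
    unfolding square_block_def w[symmetric] by (intro sum.cong) (auto simp: x_def)
  then show thesis using that[of x] by (simp add: x_def)
qed

lemma computes_args:
  assumes "i < m + 2"
  shows "computes (4 * m + 9) (\<lambda>x. args x i)"
proof -
  have "computes (4 * m + 9) (\<lambda>x. square_block x i)" if "i < m + 2" for i
    unfolding square_block_def using that
    by (intro computes_sum computes_power computes_proj) auto
  from this[of 0] this[of 1] this[of i] show ?thesis
    unfolding args_def using assms
    by (cases "i = 0"; cases "i = 1") (simp_all add: computes_add computes_proj)
qed

lemma args_cong:
  assumes "\<And>i. i \<in> {1..4 * m + 9} \<Longrightarrow> x i = y i" "i < m + 2"
  shows "args x i = args y i"
proof -
  have "square_block x i = square_block y i" if "i < m + 2" for i
    by (rule square_block_cong[of m]) (use assms(1) that in auto)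
  from this[of 0] this[of 1] this[of i] show ?thesis
    unfolding args_def using assms(2) assms(1)[of 1] by simp
qed

text \<open>Blocks 0 and 1 are both spent on the value \<open>v\<close>, so the unknown
  \<open>l ! i\<close>, which is variable \<open>i + 2\<close> of \<open>W\<close>, is exactly block
  \<open>i + 2\<close>.\<close>

lemma eval_poly_args:
  assumes "vars W \<subseteq> {..<2 + m}" "x 1 = int k" "square_block x 0 + square_block x 1 = int v"
    "length l = m" "\<And>i. i < m \<Longrightarrow> square_block x (i + 2) = int (l ! i)"
  shows "eval_poly W (args x) = eval_poly W (\<lambda>i. int (([k, v] @ l) ! i))"
proof (rule eval_poly_cong)
  fix i
  assume "i \<in> vars W"
  then have "i < 2 + m" using assms(1) by auto
  then consider "i = 0" | "i = 1" | i' where "i = Suc (Suc i')" "i' < m"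
    by (cases i; cases "i - 1") auto
  then show "args x i = int (([k, v] @ l) ! i)"
    using assms(2-4) assms(5)[of "i - 2"] by cases (auto simp: args_def)
qed

theorem theorem4:
  shows "\<not> (\<exists>(m :: nat) (W :: int_mpoly).
           diophantine_representation 2 m W (graph_on {1..} g) \<and> finite_fold 2 m W)"
proof
  assume "\<exists>(m :: nat) (W :: int_mpoly).
    diophantine_representation 2 m W (graph_on {1..} g) \<and> finite_fold 2 m W"
  then obtain m W where rep: "diophantine_representation 2 m W (graph_on {1..} g)"
    and ff: "finite_fold 2 m W" by blast
  have vars: "vars W \<subseteq> {..<2 + m}" using rep unfolding diophantine_representation_def by blast
  have graph: "v = g n \<and> n \<ge> 1 \<longleftrightarrow> (\<exists>l. l \<in> nat_zeros m W [n, v])" for n v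
  proof -
    have "[n, v] \<in> graph_on {1..} g \<longleftrightarrow> (\<exists>l. l \<in> nat_zeros m W [n, v])"
      using rep unfolding diophantine_representation_def by simp
    then show ?thesis by (auto simp: graph_on_def)
  qed
  define d where "d = 4 * m + 9"
  define F where "F x = eval_poly W (args x)" for x
  have F_cong: "F x = F y" if "\<And>i. i \<in> {1..d} \<Longrightarrow> x i = y i" for x y
    unfolding F_def using that vars args_cong[of m x y]
    by (intro eval_poly_cong) (auto simp: d_def)
  have "computes d (\<lambda>x. eval_poly W (\<lambda>i. args x i))"
    unfolding d_def using vars by (intro computes_eval_poly computes_args) auto
  then have "computes d F" unfolding F_def .
  then obtain C where C: "\<And>j N. C + j \<le> N \<Longrightarrow> \<exists>S\<subseteq>E N. bij_betw (\<lambda>y. restrict y {1..d})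
      (solutions N S) {x \<in> {1..d} \<rightarrow>\<^sub>E UNIV. x 1 = 2 ^ j \<and> F x = 0}"
    using system_for_zeros[of d F, OF _ _ F_cong] by (auto simp: d_def)
  \<comment> \<open>The choice \<open>j = C + 1\<close> suffices: \<open>C < 2 ^ C\<close> gives
    \<open>C + j < 2 * 2 ^ C = k\<close>.\<close>
  define k :: nat where "k = 2 ^ (C + 1)"
  define A where "A = {x \<in> {1..d} \<rightarrow>\<^sub>E UNIV. x 1 = int k \<and> F x = 0}"
  have "C < 2 ^ C" by (rule less_exp)
  then have "C + (C + 1) \<le> k" unfolding k_def power_add power_one_right by linarith
  from C[OF this] obtain S where S: "S \<subseteq> E k" "bij_betw (\<lambda>y. restrict y {1..d}) (solutions k S) A"
    unfolding A_def k_def by auto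
  have k: "k \<ge> 1" by (simp add: k_def)
  define Z where "Z = nat_zeros m W [k, g k]"
  have finZ: "finite Z" using ff unfolding Z_def finite_fold_def by simp
  \<comment> \<open>One bound for all coordinates of points of \<open>A\<close>: \<open>k\<close>
    handles variable 1, \<open>g k\<close> handles blocks 0 and 1, and the sum over the finite fibre
    \<open>Z\<close> handles the blocks coding unknowns.\<close>
  define B where "B = int k + int (g k) + (\<Sum>l\<in>Z. int (sum_list l))"

  have fin: "finite A"
  proof (rule finite_subset)
    show "finite ({1..d} \<rightarrow>\<^sub>E {-B..B})" by (intro finite_PiE) auto
    show "A \<subseteq> {1..d} \<rightarrow>\<^sub>E {-B..B}"
    proof
      fix x
      assume x: "x \<in> A"
      define v where "v = nat (square_block x 0 + square_block x 1)"
      define l where "l = map (\<lambda>i. nat (square_block x (i + 2))) [0..<m]"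
      note nn = square_block_nonneg[of x]
      have v: "square_block x 0 + square_block x 1 = int v" using nn[of 0] nn[of 1] by (simp add: v_def)
      have l: "length l = m" "\<And>i. i < m \<Longrightarrow> square_block x (i + 2) = int (l ! i)"
        using nn by (auto simp: l_def)
      have "F x = eval_poly W (\<lambda>i. int (([k, v] @ l) ! i))"
        unfolding F_def by (rule eval_poly_args[OF vars]) (use x v l in \<open>auto simp: A_def\<close>)
      then have lz: "l \<in> nat_zeros m W [k, v]" using x l(1) by (auto simp: A_def nat_zeros_def)
      \<comment> \<open>A zero of \<open>W\<close> forces the value of \<open>g\<close>, so only the
        single fibre \<open>Z\<close> matters.\<close>
      then have vk: "v = g k" using graph by blast
      have lZ: "l \<in> Z" using lz vk by (simp add: Z_def)
      have nnS: "(\<Sum>l\<in>Z. int (sum_list l)) \<ge> 0" by (intro sum_nonneg) simp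
      have block: "square_block x i \<le> B" if "i < m + 2" for i
      proof (cases "i < 2")
        case True
        then have "i = 0 \<or> i = 1" by auto
        then have "square_block x i \<le> int (g k)" using v vk nn[of 0] nn[of 1] by auto
        then show ?thesis using nnS by (simp add: B_def)
      next
        case False
        define i' where "i' = i - 2"
        have i': "i = i' + 2" "i' < m" using False that by (auto simp: i'_def)
        have "l ! i' \<le> sum_list l" using i' l(1) by (intro member_le_sum_list) auto
        also have "int (sum_list l) \<le> (\<Sum>l\<in>Z. int (sum_list l))"
          using member_le_sum[of l Z "\<lambda>l. int (sum_list l)"] lZ finZ by auto
        finally show ?thesis using l(2)[OF i'(2)] i' by (simp add: B_def)
      qed
      have "x t \<in> {-B..B}" if "t \<in> {1..d}" for t
      proof (cases "t = 1")
        case True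
        then show ?thesis using x nnS by (simp add: A_def B_def)
      next
        case False
        then have "t \<ge> 2" "(t - 2) div 4 < m + 2" using that by (auto simp: d_def)
        then show ?thesis using abs_le_square_block[of t x] block[of "(t - 2) div 4"]
          by (auto simp: abs_le_iff)
      qed
      then show "x \<in> {1..d} \<rightarrow>\<^sub>E {-B..B}" using x by (auto simp: A_def PiE_iff)
    qed
  qed

  obtain l where l: "l \<in> Z" using graph[of "g k" k] k unfolding Z_def by blast
  \<comment> \<open>Each splitting \<open>g k = u + (g k - u)\<close> is realised with the same
    witness \<open>l\<close>, and block 0 recovers \<open>u\<close>; hence \<open>A\<close> has at
    least \<open>g k + 1\<close> elements.\<close>
  have "{..g k} \<subseteq> (\<lambda>x. nat (square_block x 0)) ` A"
  proof
    fix u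
    assume u: "u \<in> {..g k}"
    define z where "z i = (if i = 0 then u else if i = 1 then g k - u else l ! (i - 2))" for i
    obtain x where x: "x 1 = int k" "\<And>i. square_block x i = int (z i)"
      using exists_square_blocks by blast
    have "F x = eval_poly W (\<lambda>i. int (([k, g k] @ l) ! i))"
      unfolding F_def by (rule eval_poly_args[OF vars])
        (use x u l in \<open>auto simp: z_def Z_def nat_zeros_def\<close>)
    then have "F x = 0" using l by (simp add: Z_def nat_zeros_def)
    define y where "y = restrict x {1..d}"
    have "F y = F x" by (rule F_cong) (simp add: y_def)
    with \<open>F x = 0\<close> have "y \<in> A" using x(1) by (simp add: A_def y_def d_def)
    moreover have "square_block y 0 = int u"
      using square_block_cong[of m y x 0] x(2)[of 0] by (simp add: y_def d_def z_def)
    ultimately show "u \<in> (\<lambda>x. nat (square_block x 0)) ` A" by force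
  qed
  then have "card {..g k} \<le> card A"
    using fin by (rule surj_card_le[rotated])
  moreover have "card (solutions k S) = card A" by (rule bij_betw_same_card[OF S(2)])
  ultimately have "g k < card (solutions k S)" by simp
  moreover have "finite (solutions k S)" using bij_betw_finite[OF S(2)] fin by simp
  then have "card (solutions k S) \<le> g k"
    unfolding g_def using S(1) by (intro Max_ge g_Max_wellformed(1)[OF k]) blast
  ultimately show False by simp
qed

end
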